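(* Let $I\subset\mathbb R$ be an open interval, let $\alpha_t,\beta_t,\gamma_t:I\to\mathbb R$ be continuously differentiable functions of $t$, let $f:\mathcal E(\mu)\to\mathbb R$ be a smooth scalar field, and consider the damped Kullback–Leibler Lagrangian on the statistical bundle $$L(q,w,t)=e^{\gamma_t}\left(e^{\alpha_t}D\big(q,e_q(e^{-\alpha_t}w)\big)-e^{\alpha_t+\beta_t}f(q)\right)=e^{\alpha_t+\gamma_t}\left(K_q(e^{-\alpha_t}w)-e^{\beta_t}f(q)\right).$$ For a smooth curve $t\mapsto q(t)\in\mathcal E(\mu)$, put $\chi(t)=e_{q(t)}\big(e^{-\alpha_t}\overset{\star}{q}(t)\big)$. Then the Euler–Lagrange equation $$\frac{D}{dt}\,\mathrm{Grad}_{e}L(q(t),\overset{\star}{q}(t),t)=\mathrm{Grad}\,L(q(t),\overset{\star}{q}(t),t)$$ can be equivalently written as $$e^{-\alpha_t}\,\overset{\star\star}{q}(t)+\left(1-\dot\alpha_te^{-\alpha_t}\right)\overset{\star}{q}(t)=\left(e^{\alpha_t}-\dot\gamma_t\right)\left(-\frac{q(t)}{\chi(t)}+\mathbb E_{q(t)}\left[\frac{q(t)}{\chi(t)}\right]\right)-e^{\alpha_t+\beta_t}\left(\frac{q(t)}{\chi(t)}\mathrm{Grad}f(q(t))-\mathbb E_{q(t)}\left[\frac{q(t)}{\chi(t)}\mathrm{Grad}f(q(t))\right]\right).$$ Under the ideal scaling conditions $\dot\beta_t\le e^{\alpha_t}$, $\dot\gamma_t=e^{\alpha_t}$, it reduces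 to $$\overset{\star\star}{q}(t)+\left(e^{\alpha_t}-\dot\alpha_t\right)\overset{\star}{q}(t)=-e^{2\alpha_t+\beta_t}\left(\frac{q(t)}{\chi(t)}\mathrm{Grad}f(q(t))-\mathbb E_{q(t)}\left[\frac{q(t)}{\chi(t)}\mathrm{Grad}f(q(t))\right]\right).$$
   Context: $\Omega$ is a finite set with $N$ elements and $\mu$ is the uniform probability on $\Omega$. $\mathcal E(\mu)$ is the set of strictly positive probability densities with respect to $\mu$, i.e. functions $q:\Omega\to(0,\infty)$ with $\sum_{x}q(x)=N$. For $g:\Omega\to\mathbb R$, $\mathbb E_q[g]=\frac1N\sum_x g(x)q(x)$. The Kullback–Leibler divergence is $D(p,q)=\mathbb E_p[\log\frac pq]$. For $q\in\mathcal E(\mu)$ the exponential fiber $S_q\mathcal E(\mu)$ and the mixture fiber ${}^*S_q\mathcal E(\mu)$ are both equal, as vector spaces, to $\{v:\Omega\to\mathbb R : \mathbb E_q[v]=0\}$, with duality pairing $\langle\eta,v\rangle_q=\mathbb E_q[\eta v]$. The statistical bundle is $\{(q,w):q\in\mathcal E(\mu),w\in S_q\mathcal E(\mu)\}$. The exponential transport is ${}^{e}\mathbb U_p^q v=v-\mathbb E_q[v]$ from $S_p\mathcal E(\mu)$ to $S_q\mathcal E(\mu)$. For $q\in\mathcal E(\mu)$ and $w\in S_q\mathcal E(\mu)$, $K_q(w)=\log\mathbb E_q[e^w]$ and $e_q(w)=e^{w-K_q(w)}\,q\in\mathcal E(\mu)$; $e_q$ is a bijection $S_q\mathcal E(\mu)\to\mathcal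 E(\mu)$. A dot denotes the ordinary time derivative. The velocity of a smooth curve $q(t)$ in $\mathcal E(\mu)$ is $\overset{\star}{q}(t)=\frac{d}{dt}\log q(t)=\dot q(t)/q(t)\in S_{q(t)}\mathcal E(\mu)$, and its (exponential) acceleration is $\overset{\star\star}{q}(t)=\frac{d}{dt}\overset{\star}{q}(t)-\mathbb E_{q(t)}\big[\frac{d}{dt}\overset{\star}{q}(t)\big]$. The mixture covariant derivative of $\eta(t)\in{}^*S_{q(t)}\mathcal E(\mu)$ along $q(t)$ is $\frac{D}{dt}\eta=\overset{\star}{q}\,\eta+\dot\eta$; this is the derivative used in the Euler–Lagrange equation. The natural gradient $\mathrm{Grad}f(q)\in{}^*S_q\mathcal E(\mu)$ is defined by $\frac{d}{dt}f(q(t))=\langle\mathrm{Grad}f(q(t)),\overset{\star}{q}(t)\rangle_{q(t)}$ for every smooth curve. Gradients of a Lagrangian $L(q,w,t)$: $\mathrm{Grad}_{e}L(q,w,t)\in{}^*S_q\mathcal E(\mu)$ is defined by $\frac{d}{ds}L(q,w+s\beta,t)|_{s=0}=\langle\mathrm{Grad}_{e}L(q,w,t),\beta\rangle_q$ for all $\beta\in S_q\mathcal E(\mu)$; $\mathrm{Grad}\,L(q,w,t)\in{}^*S_q\mathcal E(\mu)$ satisfies, for any $p\in\mathcal E(\mu)$, with $L_p(u,v,t)=L(e_p(u),{}^{e}\mathbb U_p^{e_p(u)}v,t)$, $q=e_p(u)$, $w={}^{e}\mathbb U_p^q v$: $\langle\mathrm{Grad}\,L(q,w,t),h\rangle_q=D_1L_p(u,v,t)[{}^{e}\mathbb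 U_q^p h]$ for all $h\in S_q\mathcal E(\mu)$, where $D_1$ is the differential in $u$. *)

theory Defs
  imports "HOL-Analysis.Analysis"
begin

text \<open>
  The finite sample space is a type \<open>'n\<close> of class \<open>finite\<close>, so its cardinality is
  \<open>CARD('n)\<close>, and real functions on it are the vectors of type \<open>real^'n\<close>, which carry
  the Euclidean topology needed for differentiation. The product \<open>*\<close> and the unit \<open>1\<close> of
  \<open>real^'n\<close> are pointwise, and \<open>vec c\<close> is the constant function with value \<open>c\<close>.
\<close>

definition densities :: "(real^'n) set" where
  "densities = {q. (\<forall>x. 0 < q $ x) \<and> (\<Sum>x\<in>UNIV. q $ x) = real CARD('n)}"

definition expect :: "real^'n \<Rightarrow> real^'n \<Rightarrow> real" where
  "expect q g = (1 / real CARD('n)) * (\<Sum>x\<in>UNIV. g $ x * q $ x)"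

definition KL_div :: "real^'n \<Rightarrow> real^'n \<Rightarrow> real" where
  "KL_div p q = expect p (\<chi> x. ln (p $ x / q $ x))"

text \<open>The exponential and the mixture fiber at \<open>q\<close> are the same vector space.\<close>

definition fiber :: "real^'n \<Rightarrow> (real^'n) set" where
  "fiber q = {v. expect q v = 0}"

definition pairing :: "real^'n \<Rightarrow> real^'n \<Rightarrow> real^'n \<Rightarrow> real" where
  "pairing q \<eta> v = expect q (\<eta> * v)"

definition exp_transport :: "real^'n \<Rightarrow> real^'n \<Rightarrow> real^'n \<Rightarrow> real^'n" where
  "exp_transport p q v = v - vec (expect q v)"

definition cumulant :: "real^'n \<Rightarrow> real^'n \<Rightarrow> real" where
  "cumulant q w = ln (expect q (\<chi> x. exp (w $ x)))"

definition exp_chart_inv :: "real^'n \<Rightarrow> real^'n \<Rightarrow> real^'n" where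
  "exp_chart_inv q w = (\<chi> x. exp (w $ x - cumulant q w) * q $ x)"

text \<open>
  \<open>Ck_on k S V F\<close> is \<open>k\<close>-fold continuous differentiability of \<open>F\<close> on \<open>S\<close>, where \<open>S\<close> is
  a relatively open subset of a translate of the linear subspace \<open>V\<close>. The Frechet
  derivative within \<open>S\<close> is determined on the directions in \<open>V\<close> only, hence the iteration
  over \<open>v \<in> V\<close>; in finite dimension, continuity of all these directional
  derivatives is continuity of the derivative. It is used with \<open>S\<close> an open
  real interval and \<open>V = UNIV\<close>, and with \<open>S = V\<close> a fiber.
\<close>

fun Ck_on :: "nat \<Rightarrow> 'v::real_normed_vector set \<Rightarrow> 'v set \<Rightarrow> ('v \<Rightarrow> 'w::real_normed_vector) \<Rightarrow> bool"
where
  "Ck_on 0 S V F = continuous_on S F"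
| "Ck_on (Suc k) S V F =
    (\<exists>F'. (\<forall>x\<in>S. (F has_derivative F' x) (at x within S)) \<and> (\<forall>v\<in>V. Ck_on k S V (\<lambda>x. F' x v)))"

definition smooth_curve :: "real set \<Rightarrow> (real \<Rightarrow> real^'n) \<Rightarrow> bool" where
  "smooth_curve J c \<longleftrightarrow> (\<forall>t\<in>J. c t \<in> densities) \<and> (\<forall>k. Ck_on k J UNIV c)"

text \<open>
  Smoothness of a scalar field on the manifold of densities is smoothness in all exponential
  charts; values of \<open>f\<close> outside \<open>densities\<close> are irrelevant.
\<close>

definition smooth_field :: "(real^'n \<Rightarrow> real) \<Rightarrow> bool" where
  "smooth_field f \<longleftrightarrow>
    (\<forall>p\<in>densities. \<forall>k. Ck_on k (fiber p) (fiber p) (\<lambda>u. f (exp_chart_inv p u)))"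

definition velocity :: "(real \<Rightarrow> real^'n) \<Rightarrow> real \<Rightarrow> real^'n" where
  "velocity q t = vector_derivative (\<lambda>s. \<chi> x. ln (q s $ x)) (at t)"

definition acceleration :: "(real \<Rightarrow> real^'n) \<Rightarrow> real \<Rightarrow> real^'n" where
  "acceleration q t =
    vector_derivative (velocity q) (at t) - vec (expect (q t) (vector_derivative (velocity q) (at t)))"

definition mixture_deriv :: "(real \<Rightarrow> real^'n) \<Rightarrow> (real \<Rightarrow> real^'n) \<Rightarrow> real \<Rightarrow> real^'n" where
  "mixture_deriv q \<eta> t = velocity q t * \<eta> t + vector_derivative \<eta> (at t)"

definition nat_grad :: "(real^'n \<Rightarrow> real) \<Rightarrow> real^'n \<Rightarrow> real^'n" where
  "nat_grad f q = (THE \<eta>. \<eta> \<in> fiber q \<and>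
    (\<forall>J c t. open J \<and> is_interval J \<and> smooth_curve J c \<and> t \<in> J \<and> c t = q \<longrightarrow>
      ((\<lambda>s. f (c s)) has_real_derivative pairing q \<eta> (velocity c t)) (at t)))"

type_synonym 'n lagrangian = "real^'n \<Rightarrow> real^'n \<Rightarrow> real \<Rightarrow> real"

definition fiber_grad :: "'n::finite lagrangian \<Rightarrow> real^'n \<Rightarrow> real^'n \<Rightarrow> real \<Rightarrow> real^'n" where
  "fiber_grad L q w t = (THE \<eta>. \<eta> \<in> fiber q \<and>
    (\<forall>\<beta>\<in>fiber q. ((\<lambda>s. L q (w + s *\<^sub>R \<beta>) t) has_real_derivative pairing q \<eta> \<beta>) (at 0)))"

definition local_lagrangian :: "'n::finite lagrangian \<Rightarrow> real^'n \<Rightarrow> 'n lagrangian" where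
  "local_lagrangian L p u v t = L (exp_chart_inv p u) (exp_transport p (exp_chart_inv p u) v) t"

definition base_grad :: "'n::finite lagrangian \<Rightarrow> real^'n \<Rightarrow> real^'n \<Rightarrow> real \<Rightarrow> real^'n" where
  "base_grad L q w t = (THE \<eta>. \<eta> \<in> fiber q \<and>
    (\<forall>p\<in>densities. \<forall>u\<in>fiber p. \<forall>v\<in>fiber p.
      q = exp_chart_inv p u \<and> w = exp_transport p q v \<longrightarrow>
      (\<exists>D. ((\<lambda>u'. local_lagrangian L p u' v t) has_derivative D) (at u within fiber p) \<and>
           (\<forall>h\<in>fiber q. pairing q \<eta> h = D (exp_transport q p h)))))"

definition euler_lagrange :: "'n::finite lagrangian \<Rightarrow> (real \<Rightarrow> real^'n) \<Rightarrow> real \<Rightarrow> bool" where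
  "euler_lagrange L q t \<longleftrightarrow>
    mixture_deriv q (\<lambda>s. fiber_grad L (q s) (velocity q s) s) t = base_grad L (q t) (velocity q t) t"

definition damped_KL_lagrangian ::
  "(real \<Rightarrow> real) \<Rightarrow> (real \<Rightarrow> real) \<Rightarrow> (real \<Rightarrow> real) \<Rightarrow> (real^'n \<Rightarrow> real) \<Rightarrow> 'n::finite lagrangian" where
  "damped_KL_lagrangian \<alpha> \<beta> \<gamma> f q w t =
    exp (\<gamma> t) * (exp (\<alpha> t) * KL_div q (exp_chart_inv q (exp (- \<alpha> t) *\<^sub>R w)) - exp (\<alpha> t + \<beta> t) * f q)"

end

theory Submission
  imports Defs
begin

text \<open>
  Write \<open>a = e\<^sup>-\<^sup>\<alpha>\<close>, \<open>w\<close> for the velocity, \<open>X = e_q(a w)\<close> and \<open>\<rho> = X / q\<close>. All computations rest on the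
  derivative of the cumulant function of an exponential family, which is the expectation under the
  tilted density (\<open>cumulant_has_derivative\<close>). It gives \<open>Grad_e L = e\<^sup>\<gamma> (\<rho> - 1)\<close> (\<open>fiber_grad_damped_KL\<close>)
  and, together with the covariance as derivative of the expectation under \<open>e_p(u)\<close>,
  \<open>Grad L = e\<^sup>\<alpha>\<^sup>+\<^sup>\<gamma> (\<rho> - 1 - a w - e\<^sup>\<beta> Grad f)\<close>
  (\<open>base_grad_damped_KL\<close>). All gradients are defined by descriptions, so existence and uniqueness are
  part of the work: the pairing represents every functional and is nondegenerate on the fiber, the
  natural gradient is found in the exponential chart centered at \<open>q\<close>, and it is unique because
  every fiber vector is the velocity of some smooth curve.

  Along the curve, \<open>\<rho>\<close> has derivative \<open>\<rho> ((a w)' - E_X[w + (a w)'])\<close>. In the Euler-Lagrange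
  equation, the summand \<open>- e\<^sup>\<alpha> a w = - w\<close> of \<open>Grad L\<close> cancels against the \<open>- w\<close> contained in
  \<open>w (\<rho> - 1)\<close> on the left, and division by \<open>\<rho>\<close> leaves, with \<open>Y = w + (a w)'\<close> and \<open>r = q / X\<close>,
  \<open>Y - E_X[Y] = (e\<^sup>\<alpha> - \<gamma>') (1 - r) - e\<^sup>\<alpha>\<^sup>+\<^sup>\<beta> r Grad f\<close>. The right-hand side has \<open>X\<close>-expectation 0, because
  \<open>E_X[r g] = E_q[g]\<close>. Hence the equation only says that the two sides agree up to a constant
  (\<open>centering_change_density\<close>), and so it may be centered at \<open>q\<close> instead of \<open>X\<close>, which is the
  asserted second-order equation. The ideal scaling makes the first summand on the right vanish.
\<close>

section \<open>Componentwise derivatives\<close>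

lemma has_derivative_vec_iff:
  fixes f :: "'a::real_normed_vector \<Rightarrow> real^'n"
  shows "(f has_derivative f') (at x within S) \<longleftrightarrow>
    (\<forall>i. ((\<lambda>x. f x $ i) has_derivative (\<lambda>h. f' h $ i)) (at x within S))"
  unfolding has_derivative_componentwise_within[of f]
  by (auto simp: Basis_vec_def inner_axis)

lemma has_vector_derivative_vec_iff:
  fixes f :: "real \<Rightarrow> real^'n"
  shows "(f has_vector_derivative f') (at t) \<longleftrightarrow>
    (\<forall>i. ((\<lambda>s. f s $ i) has_real_derivative f' $ i) (at t))"
proof -
  have "(\<lambda>h. h * f' $ i) = (*) (f' $ i)" for i
    by (simp add: fun_eq_iff)
  then show ?thesis
    by (simp add: has_vector_derivative_def has_derivative_vec_iff has_field_derivative_def)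
qed

section \<open>Expectations, exponential charts and the cumulant function\<close>

definition log_vec :: "real^'n \<Rightarrow> real^'n" where
  "log_vec q = (\<chi> x. ln (q $ x))"

text \<open>
  The ratio \<open>e_q(w) / q\<close>: it turns expectations under \<open>e_q(w)\<close> into expectations under \<open>q\<close>, and
  both gradients of the Lagrangian are expressed through it.
\<close>

definition tilt :: "real^'n \<Rightarrow> real^'n \<Rightarrow> real^'n" where
  "tilt q w = (\<chi> x. exp (w $ x - cumulant q w))"

text \<open>
  The inverse of the bijection \<open>e_p\<close> from the fiber at \<open>p\<close> to the densities.
\<close>

definition exp_chart :: "real^'n \<Rightarrow> real^'n \<Rightarrow> real^'n" where
  "exp_chart p q = exp_transport q p (log_vec q - log_vec p)"

lemma expect_add: "expect q (g + h) = expect q g + expect q h"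
  by (simp add: expect_def algebra_simps sum.distrib)

lemma expect_diff: "expect q (g - h) = expect q g - expect q h"
  by (simp add: expect_def algebra_simps sum_subtractf)

lemma expect_minus: "expect q (- g) = - expect q g"
  by (simp add: expect_def sum_negf)

lemma expect_scaleR: "expect q (c *\<^sub>R g) = c * expect q g"
  by (simp add: expect_def sum_distrib_left mult_ac)

lemma expect_0: "expect q 0 = 0"
  by (simp add: expect_def)

lemma expect_mult_density: "expect (\<rho> * q) g = expect q (\<rho> * g)"
  by (simp add: expect_def mult_ac)

lemma densities_iff: "q \<in> densities \<longleftrightarrow> (\<forall>x. 0 < q $ x) \<and> expect q 1 = 1"
  by (auto simp: densities_def expect_def field_simps)

lemma vec_eq_scaleR_1: "(vec c :: real^'n) = c *\<^sub>R 1"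
  by (simp add: vec_eq_iff)

lemma expect_vec: "q \<in> densities \<Longrightarrow> expect q (vec c) = c"
  by (simp add: vec_eq_scaleR_1 expect_scaleR densities_iff)

lemma expect_1: "q \<in> densities \<Longrightarrow> expect q 1 = 1"
  by (simp add: densities_iff)

lemmas expect_simps = expect_add expect_diff expect_minus expect_scaleR expect_0 expect_vec expect_1

lemma bounded_linear_expect: "bounded_linear (expect q)"
  by (rule linear_conv_bounded_linear[THEN iffD1], rule linearI)
    (simp_all add: expect_simps)

lemma bounded_linear_expect_left: "bounded_linear (\<lambda>q. expect q g)"
  by (rule linear_conv_bounded_linear[THEN iffD1], rule linearI)
    (simp_all add: expect_def algebra_simps sum.distrib sum_distrib_left)

lemma bounded_linear_exp_transport: "bounded_linear (exp_transport p q)"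
proof -
  have "bounded_linear (\<lambda>d. d - expect q d *\<^sub>R 1)"
    by (intro bounded_linear_sub bounded_linear_ident
        bounded_linear_compose[OF bounded_linear_scaleR_left bounded_linear_expect])
  then show ?thesis
    by (simp add: exp_transport_def[abs_def] vec_eq_scaleR_1)
qed

lemma densities_pos: "q \<in> densities \<Longrightarrow> 0 < q $ x"
  by (simp add: densities_def)

lemma one_density: "(1 :: real^'n) \<in> densities"
  by (simp add: densities_def)

lemma expect_pos:
  fixes q :: "real^'n"
  assumes "q \<in> densities" and "\<And>x. 0 < g $ x"
  shows "0 < expect q g"
  using assms unfolding expect_def
  by (intro mult_pos_pos sum_pos) (auto simp: densities_pos)

lemma exp_cumulant:
  "q \<in> densities \<Longrightarrow> exp (cumulant q w) = expect q (\<chi> x. exp (w $ x))"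
  unfolding cumulant_def by (rule exp_ln, rule expect_pos) auto

lemma tilt_eq: "q \<in> densities \<Longrightarrow>
    tilt q w = (1 / expect q (\<chi> x. exp (w $ x))) *\<^sub>R (\<chi> x. exp (w $ x))"
  by (simp add: tilt_def vec_eq_iff exp_diff exp_cumulant)

lemma expect_tilt: "q \<in> densities \<Longrightarrow> expect q (tilt q w) = 1"
  using expect_pos[of q "\<chi> x. exp (w $ x)"] by (simp add: tilt_eq expect_scaleR)

lemma exp_chart_inv_eq_tilt: "exp_chart_inv q w = tilt q w * q"
  by (simp add: exp_chart_inv_def tilt_def vec_eq_iff)

lemma exp_chart_inv_in_densities: "q \<in> densities \<Longrightarrow> exp_chart_inv q w \<in> densities"
  by (auto simp: densities_iff exp_chart_inv_eq_tilt expect_mult_density expect_tilt)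
    (simp add: tilt_def)

lemma cumulant_0: "q \<in> densities \<Longrightarrow> cumulant q 0 = 0"
  using expect_1[of q] by (simp add: cumulant_def one_vec_def)

text \<open>
  Both sides are the logarithm of \<open>E_p[exp (u + w)] / E_p[exp u]\<close>. This cocycle identity lets the
  cumulant at a moving base point be computed from the cumulant at a fixed one.
\<close>

lemma cumulant_chart_inv:
  assumes "p \<in> densities"
  shows "cumulant (exp_chart_inv p u) w = cumulant p (u + w) - cumulant p u"
proof -
  have "expect (exp_chart_inv p u) (\<chi> x. exp (w $ x))
      = exp (- cumulant p u) * expect p (\<chi> x. exp ((u + w) $ x))"
    by (simp add: expect_def exp_chart_inv_def exp_diff exp_minus exp_add sum_distrib_left field_simps)
  then have "exp (cumulant (exp_chart_inv p u) w) = exp (cumulant p (u + w) - cumulant p u)"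
    by (simp only: exp_cumulant[OF assms, symmetric] exp_diff exp_minus divide_inverse mult.commute
        exp_cumulant[OF exp_chart_inv_in_densities[OF assms], symmetric])
  then show ?thesis by simp
qed

lemma cumulant_add_vec:
  assumes "q \<in> densities"
  shows "cumulant q (w + vec c) = cumulant q w + c"
proof -
  have "exp (cumulant q (w + vec c)) = exp (cumulant q w + c)"
    using assms
    by (simp add: exp_cumulant exp_add expect_def sum_distrib_left sum_distrib_right mult_ac)
  then show ?thesis by simp
qed

lemma exp_chart_inv_chart_inv:
  "p \<in> densities \<Longrightarrow> exp_chart_inv (exp_chart_inv p u) w = exp_chart_inv p (u + w)"
  unfolding exp_chart_inv_def[of _ w] exp_chart_inv_def[of p "u + w"]
  by (simp add: cumulant_chart_inv vec_eq_iff)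
    (simp add: exp_chart_inv_def mult.assoc[symmetric] exp_add[symmetric])

lemma exp_chart_inv_add_vec:
  "p \<in> densities \<Longrightarrow> exp_chart_inv p (u + vec c) = exp_chart_inv p u"
  by (simp add: exp_chart_inv_def cumulant_add_vec)

lemma exp_chart_inv_log_ratio:
  assumes "p \<in> densities" "q \<in> densities"
  shows "cumulant p (log_vec q - log_vec p) = 0"
    and "exp_chart_inv p (log_vec q - log_vec p) = q"
proof -
  have *: "exp ((log_vec q - log_vec p) $ x) = q $ x / p $ x" for x
    using assms[THEN densities_pos] by (simp add: log_vec_def exp_diff)
  then have "expect p (\<chi> x. exp ((log_vec q - log_vec p) $ x)) = expect q 1"
    using densities_pos[OF assms(1)] by (simp add: expect_def less_imp_neq[THEN not_sym])
  then show "cumulant p (log_vec q - log_vec p) = 0"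
    using assms by (simp add: cumulant_def expect_1)
  then show "exp_chart_inv p (log_vec q - log_vec p) = q"
    using * densities_pos[OF assms(1)]
    by (simp add: exp_chart_inv_def vec_eq_iff less_imp_neq[THEN not_sym])
qed

lemma exp_chart_in_fiber: "p \<in> densities \<Longrightarrow> exp_chart p q \<in> fiber p"
  by (simp add: exp_chart_def exp_transport_def fiber_def expect_simps)

lemma exp_chart_inv_exp_chart:
  assumes "p \<in> densities" "q \<in> densities"
  shows "exp_chart_inv p (exp_chart p q) = q"
  using exp_chart_inv_add_vec[OF assms(1), of "log_vec q - log_vec p"
      "- expect p (log_vec q - log_vec p)"] assms
  by (simp add: exp_chart_def exp_transport_def exp_chart_inv_log_ratio vec_neg)

lemma exp_chart_exp_chart_inv:
  assumes "p \<in> densities" "u \<in> fiber p"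
  shows "exp_chart p (exp_chart_inv p u) = u"
proof -
  have "log_vec (exp_chart_inv p u) - log_vec p = u - vec (cumulant p u)"
    using densities_pos[OF assms(1)]
    by (simp add: log_vec_def exp_chart_inv_def vec_eq_iff ln_mult less_imp_neq[THEN not_sym])
  then show ?thesis
    using assms by (simp add: exp_chart_def exp_transport_def fiber_def expect_simps vec_neg)
qed

text \<open>
  Along a curve \<open>q\<close> the base point of \<open>K_q(w)\<close> moves. Referring everything to the uniform density
  removes this dependence, so that one derivative formula, in the argument only, is enough.
\<close>

lemma cumulant_eq_uniform:
  assumes "q \<in> densities"
  shows "cumulant q w = cumulant 1 (log_vec q + w)"
    and "exp_chart_inv q w = exp_chart_inv 1 (log_vec q + w)"
proof -
  have *: "log_vec (1 :: real^'n) = 0" by (simp add: log_vec_def vec_eq_iff)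
  have q: "exp_chart_inv 1 (log_vec q) = q" "cumulant 1 (log_vec q) = 0"
    using exp_chart_inv_log_ratio[OF one_density assms] by (simp_all add: *)
  show "cumulant q w = cumulant 1 (log_vec q + w)"
    using cumulant_chart_inv[OF one_density, of "log_vec q" w] by (simp add: q)
  show "exp_chart_inv q w = exp_chart_inv 1 (log_vec q + w)"
    using exp_chart_inv_chart_inv[OF one_density, of "log_vec q" w] by (simp add: q)
qed

lemma cumulant_has_derivative:
  fixes p u :: "real^'n"
  assumes "p \<in> densities"
  shows "(cumulant p has_derivative expect (exp_chart_inv p u)) (at u within S)"
proof -
  have "((\<lambda>u. (\<chi> x. exp (u $ x)) :: real^'n) has_derivative (\<lambda>k. \<chi> x. exp (u $ x) * k $ x)) (at u within S)"
    unfolding has_derivative_vec_iff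
    by (auto intro!: derivative_eq_intros bounded_linear_imp_has_derivative bounded_linear_vec_nth)
  from bounded_linear.has_derivative[OF bounded_linear_expect[of p] this]
  have "((\<lambda>u. expect p (\<chi> x. exp (u $ x))) has_derivative
      (\<lambda>k. expect p (\<chi> x. exp (u $ x) * k $ x))) (at u within S)" .
  then have "((\<lambda>u. ln (expect p (\<chi> x. exp (u $ x)))) has_derivative
      (\<lambda>k. expect p (\<chi> x. exp (u $ x) * k $ x) * inverse (expect p (\<chi> x. exp (u $ x))))) (at u within S)"
    using expect_pos[OF assms, of "\<chi> x. exp (u $ x)"]
    by (auto intro!: derivative_eq_intros simp: field_simps)
  moreover have "expect (exp_chart_inv p u)
      = (\<lambda>k. expect p (\<chi> x. exp (u $ x) * k $ x) * inverse (expect p (\<chi> x. exp (u $ x))))"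
  proof
    fix k
    have "tilt p u * k = inverse (expect p (\<chi> x. exp (u $ x))) *\<^sub>R (\<chi> x. exp (u $ x) * k $ x)"
      by (simp add: tilt_eq[OF assms] vec_eq_iff divide_inverse)
    then show "expect (exp_chart_inv p u) k
        = expect p (\<chi> x. exp (u $ x) * k $ x) * inverse (expect p (\<chi> x. exp (u $ x)))"
      by (simp add: exp_chart_inv_eq_tilt expect_mult_density expect_scaleR)
  qed
  ultimately show ?thesis
    unfolding cumulant_def by (simp only:)
qed

lemma tilt_has_derivative:
  assumes "p \<in> densities"
  shows "(tilt p has_derivative (\<lambda>k. tilt p u * (k - vec (expect (exp_chart_inv p u) k)))) (at u within S)"
  unfolding has_derivative_vec_iff tilt_def
  by (auto intro!: derivative_eq_intros cumulant_has_derivative[OF assms]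
      bounded_linear_imp_has_derivative bounded_linear_vec_nth)

lemma expect_chart_inv_has_derivative:
  assumes "p \<in> densities"
  shows "((\<lambda>u. expect (exp_chart_inv p u) g) has_derivative
    (\<lambda>k. expect (exp_chart_inv p u) (g * (k - vec (expect (exp_chart_inv p u) k))))) (at u within S)"
proof -
  have "bounded_linear (\<lambda>\<rho>. expect p (g * \<rho>))"
    by (rule linear_conv_bounded_linear[THEN iffD1], rule linearI)
      (simp_all add: expect_simps distrib_left)
  from bounded_linear.has_derivative[OF this tilt_has_derivative[OF assms, of u S]]
  show ?thesis
    unfolding exp_chart_inv_eq_tilt expect_mult_density by (simp add: mult_ac)
qed

section \<open>Duality on the fibers\<close>

text \<open>
  Within a proper subspace the Frechet derivative is not unique, but its values on directions of the
  subspace are, because they are derivatives along lines that stay in the subspace. This is why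
  \<open>base_grad\<close>, whose defining condition only asks for some derivative, is well defined.
\<close>

lemma has_derivative_within_subspace_unique:
  fixes F :: "'a::real_normed_vector \<Rightarrow> 'b::real_normed_vector"
  assumes "(F has_derivative D) (at u within V)" "(F has_derivative D') (at u within V)"
    and "subspace V" "u \<in> V" "h \<in> V"
  shows "D h = D' h"
proof -
  have line: "((\<lambda>s. F (u + s *\<^sub>R h)) has_derivative (\<lambda>s. E (s *\<^sub>R h))) (at 0)"
    if "(F has_derivative E) (at u within V)" for E
  proof (rule has_derivative_in_compose[where f = "\<lambda>s::real. u + s *\<^sub>R h"])
    show "((\<lambda>s. u + s *\<^sub>R h) has_derivative (\<lambda>s. s *\<^sub>R h)) (at 0)"
      by (auto intro!: derivative_eq_intros)
    have "range (\<lambda>s. u + s *\<^sub>R h) \<subseteq> V"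
      using assms by (auto intro: subspace_add subspace_scale)
    then show "(F has_derivative E) (at (u + 0 *\<^sub>R h) within range (\<lambda>s. u + s *\<^sub>R h))"
      using that by (auto intro: has_derivative_subset)
  qed
  have "(\<lambda>s. D (s *\<^sub>R h)) = (\<lambda>s. D' (s *\<^sub>R h))"
    using assms(1,2)[THEN line] by (rule has_derivative_unique)
  then show ?thesis by (metis scaleR_one)
qed

lemma subspace_fiber: "subspace (fiber q)"
  by (simp add: subspace_def fiber_def expect_simps)

lemma pairing_nondegenerate:
  assumes "q \<in> densities" "\<eta> \<in> fiber q" "\<eta>' \<in> fiber q"
    and "\<And>v. v \<in> fiber q \<Longrightarrow> pairing q \<eta> v = pairing q \<eta>' v"
  shows "\<eta> = \<eta>'"
proof -
  have "\<eta> - \<eta>' \<in> fiber q"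
    using assms(2,3) subspace_fiber by (rule subspace_diff[rotated])
  then have "expect q ((\<eta> - \<eta>') * (\<eta> - \<eta>')) = 0"
    using assms(4)[of "\<eta> - \<eta>'"] by (simp add: pairing_def expect_simps left_diff_distrib)
  then have "(\<Sum>x\<in>UNIV. ((\<eta> - \<eta>') $ x)\<^sup>2 * q $ x) = 0"
    by (simp add: expect_def power2_eq_square)
  then have "((\<eta> - \<eta>') $ x)\<^sup>2 * q $ x = 0" for x
    using densities_pos[OF assms(1)]
    by (subst (asm) sum_nonneg_eq_0_iff) (auto simp: less_imp_le)
  then show ?thesis
    using densities_pos[OF assms(1)] by (simp add: vec_eq_iff less_imp_neq[THEN not_sym])
qed

text \<open>
  The Riesz representation for the pairing: extend the functional by the centering projection so
  that it vanishes on constants, and read off the coefficients on the standard basis. Vanishing on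
  constants is what puts the representing vector into the fiber.
\<close>

lemma pairing_represents:
  fixes q :: "real^'n" and \<phi> :: "real^'n \<Rightarrow> real"
  assumes "q \<in> densities" "linear \<phi>"
  shows "\<exists>\<eta>\<in>fiber q. \<forall>v\<in>fiber q. pairing q \<eta> v = \<phi> v"
proof -
  define \<psi> where "\<psi> v = \<phi> (v - vec (expect q v))" for v
  have lin: "linear \<psi>"
    using linear_compose[OF bounded_linear.linear[OF bounded_linear_exp_transport[of q q]] assms(2)]
    by (simp add: \<psi>_def[abs_def] exp_transport_def[abs_def] o_def)
  define \<eta> :: "real^'n" where "\<eta> = (\<chi> x. real CARD('n) * \<psi> (axis x 1) / q $ x)"
  have E: "expect q (\<eta> * v) = \<psi> v" for v
  proof -
    have "expect q (\<eta> * v) = (\<Sum>x\<in>UNIV. v $ x * \<psi> (axis x 1))"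
      using densities_pos[OF assms(1)]
      by (simp add: expect_def \<eta>_def sum_distrib_left less_imp_neq[THEN not_sym] mult_ac)
    also have "\<dots> = \<psi> (\<Sum>x\<in>UNIV. v $ x *\<^sub>R axis x 1)"
      by (simp add: linear_sum[OF lin] linear_cmul[OF lin])
    also have "(\<Sum>x\<in>UNIV. v $ x *\<^sub>R axis x 1) = v"
      by (simp add: vec_eq_iff axis_def if_distrib[where f = "\<lambda>y. _ * y"] cong: if_cong)
    finally show ?thesis .
  qed
  have "\<psi> 1 = 0"
    using assms by (simp add: \<psi>_def expect_1 vec_eq_scaleR_1 linear_0)
  with E[of 1] have "\<eta> \<in> fiber q" by (simp add: fiber_def)
  moreover have "pairing q \<eta> v = \<phi> v" if "v \<in> fiber q" for v
    using that E[of v] by (simp add: pairing_def \<psi>_def fiber_def vec_eq_scaleR_1)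
  ultimately show ?thesis by blast
qed

section \<open>Smooth curves and the natural gradient\<close>

lemma log_vec_has_vector_derivative:
  assumes "(c has_vector_derivative c') (at t)" "c t \<in> densities"
  shows "((\<lambda>s. log_vec (c s)) has_vector_derivative (\<chi> x. c' $ x / c t $ x)) (at t)"
  using assms densities_pos[OF assms(2)] unfolding has_vector_derivative_vec_iff log_vec_def
  by (auto intro!: derivative_eq_intros)

lemma velocity_eq_of_derivative:
  assumes "(c has_vector_derivative c') (at t)" "c t \<in> densities"
  shows "velocity c t = (\<chi> x. c' $ x / c t $ x)"
  using vector_derivative_at[OF log_vec_has_vector_derivative[OF assms]]
  by (simp add: velocity_def log_vec_def)

lemma smooth_curve_derivatives:
  fixes c :: "real \<Rightarrow> real^'n"
  assumes "smooth_curve J c" "open J"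
  obtains c' c'' where "\<And>t. t \<in> J \<Longrightarrow> (c has_vector_derivative c' t) (at t)"
    and "\<And>t. t \<in> J \<Longrightarrow> (c' has_vector_derivative c'' t) (at t)"
proof -
  have deriv: "(F has_vector_derivative F' 1) (at t)"
    if "t \<in> J" "(F has_derivative F') (at t within J)" for F :: "real \<Rightarrow> real^'n" and F' t
  proof -
    have "F' = (\<lambda>s. s *\<^sub>R F' 1)"
    proof
      show "F' s = s *\<^sub>R F' 1" for s
        using linear_cmul[OF has_derivative_linear[OF that(2)], of s 1] by simp
    qed
    moreover have "(F has_derivative F') (at t)"
      using that(2) by (simp only: at_within_open[OF that(1) assms(2)])
    ultimately show ?thesis
      unfolding has_vector_derivative_def by (rule has_derivative_eq_rhs[rotated])
  qed
  have "Ck_on (Suc (Suc 0)) J UNIV c"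
    using assms(1) by (simp add: smooth_curve_def del: Ck_on.simps)
  then obtain F' where F': "\<And>t. t \<in> J \<Longrightarrow> (c has_derivative F' t) (at t within J)"
    and "Ck_on (Suc 0) J UNIV (\<lambda>t. F' t 1)"
    unfolding Ck_on.simps(2)[of "Suc 0"] by blast
  then obtain F'' where F'': "\<And>t. t \<in> J \<Longrightarrow> ((\<lambda>t. F' t 1) has_derivative F'' t) (at t within J)"
    by auto
  show thesis
    using that[of "\<lambda>t. F' t 1" "\<lambda>t. F'' t 1"] deriv F' F'' by blast
qed

lemma smooth_curve_velocity:
  fixes c :: "real \<Rightarrow> real^'n"
  assumes "smooth_curve J c" "open J" "t \<in> J"
  shows "((\<lambda>s. log_vec (c s)) has_vector_derivative velocity c t) (at t)"
    and "velocity c t \<in> fiber (c t)"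
    and "(velocity c has_vector_derivative vector_derivative (velocity c) (at t)) (at t)"
proof -
  obtain c' c'' where c': "\<And>t. t \<in> J \<Longrightarrow> (c has_vector_derivative c' t) (at t)"
    and c'': "\<And>t. t \<in> J \<Longrightarrow> (c' has_vector_derivative c'' t) (at t)"
    using smooth_curve_derivatives[OF assms(1,2)] by blast
  have dens: "c s \<in> densities" if "s \<in> J" for s
    using assms(1) that by (simp add: smooth_curve_def)
  have vel: "velocity c s = (\<chi> x. c' s $ x / c s $ x)" if "s \<in> J" for s
    using velocity_eq_of_derivative[OF c' dens] that by blast
  show "((\<lambda>s. log_vec (c s)) has_vector_derivative velocity c t) (at t)"
    using log_vec_has_vector_derivative[OF c' dens] assms(3) by (simp add: vel)
  have "((\<lambda>s. expect (c s) 1) has_derivative (\<lambda>s. expect (s *\<^sub>R c' t) 1)) (at t)"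
    using bounded_linear.has_derivative[OF bounded_linear_expect_left] c'[OF assms(3)]
    unfolding has_vector_derivative_def by blast
  moreover have "((\<lambda>s. expect (c s) 1) has_derivative (\<lambda>s. 0)) (at t)"
    by (rule has_derivative_transform_within_open[OF _ assms(2,3), where f = "\<lambda>_. 1"])
      (auto simp: expect_1 dens)
  ultimately have "(\<lambda>s. expect (s *\<^sub>R c' t) 1) = (\<lambda>s. 0)"
    by (rule has_derivative_unique)
  then have "expect (c' t) 1 = 0" by (metis scaleR_one)
  then show "velocity c t \<in> fiber (c t)"
    using densities_pos[OF dens[OF assms(3)]]
    by (simp add: fiber_def expect_def vel[OF assms(3)] less_imp_neq[THEN not_sym])
  have "((\<lambda>s. \<chi> x. c' s $ x / c s $ x) has_vector_derivative
      (\<chi> x. (c'' t $ x * c t $ x - c' t $ x * c' t $ x) / (c t $ x * c t $ x))) (at t)"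
    using c'[OF assms(3)] c''[OF assms(3)] densities_pos[OF dens[OF assms(3)]]
    unfolding has_vector_derivative_vec_iff
    by (auto intro!: derivative_eq_intros simp: less_imp_neq[THEN not_sym])
  then have "(velocity c has_vector_derivative
      (\<chi> x. (c'' t $ x * c t $ x - c' t $ x * c' t $ x) / (c t $ x * c t $ x))) (at t)"
    by (rule has_vector_derivative_transform_within_open[OF _ assms(2,3)]) (simp add: vel)
  then show "(velocity c has_vector_derivative vector_derivative (velocity c) (at t)) (at t)"
    by (simp add: vector_derivative_at)
qed

lemma Ck_on_const: "Ck_on k S V (\<lambda>_. c)"
proof (induction k arbitrary: c)
  case (Suc k)
  show ?case
    unfolding Ck_on.simps by (rule exI[of _ "\<lambda>_ _. 0"]) (simp add: Suc)
qed simp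

text \<open>
  Every fiber vector is a velocity. The affine curve \<open>q + s h q\<close> is the convenient witness: its
  total mass is constant because \<open>E_q[h] = 0\<close>, and its derivatives of order two and more vanish.
\<close>

lemma mixture_curve:
  fixes q h :: "real^'n"
  assumes "q \<in> densities" "h \<in> fiber q"
  shows "\<exists>J c. open J \<and> is_interval J \<and> 0 \<in> J \<and> smooth_curve J c \<and> c 0 = q \<and> velocity c 0 = h"
proof -
  \<comment> \<open>For \<open>\<bar>s\<bar> < \<epsilon>\<close> every factor \<open>1 + s h(x)\<close> is positive, since \<open>\<bar>h(x)\<bar> \<le> norm h\<close>.\<close>
  define \<epsilon> where "\<epsilon> = 1 / (1 + norm h)"
  define J where "J = {- \<epsilon><..<\<epsilon>}"
  define c where "c s = q + s *\<^sub>R (h * q)" for s :: real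
  have \<epsilon>: "0 < \<epsilon>" by (simp add: \<epsilon>_def add_pos_nonneg)
  have dens: "c s \<in> densities" if "s \<in> J" for s
  proof -
    have "0 < c s $ x" for x
    proof -
      have "\<bar>s * h $ x\<bar> \<le> \<bar>s\<bar> * norm h"
        by (simp add: abs_mult component_le_norm_cart mult_left_mono)
      also have "\<dots> \<le> \<bar>s\<bar> * (1 + norm h)"
        by (simp add: mult_left_mono)
      also have "\<dots> < \<epsilon> * (1 + norm h)"
        using that by (intro mult_strict_right_mono) (auto simp: J_def add_pos_nonneg)
      also have "\<dots> = 1" by (simp add: \<epsilon>_def add_pos_nonneg less_imp_neq[THEN not_sym])
      finally have "0 < 1 + s * h $ x" by (simp add: abs_less_iff)
      then have "0 < (1 + s * h $ x) * q $ x"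
        using densities_pos[OF assms(1)] by simp
      then show ?thesis by (simp add: c_def algebra_simps)
    qed
    moreover have "expect (c s) 1 = 1"
    proof -
      have "c s = (1 + s *\<^sub>R h) * q" by (simp add: c_def vec_eq_iff algebra_simps)
      then show ?thesis
        using assms by (simp add: expect_mult_density expect_simps fiber_def)
    qed
    ultimately show ?thesis by (simp add: densities_iff)
  qed
  have der: "(c has_derivative (\<lambda>s. s *\<^sub>R (h * q))) (at t within T)" for t T
    unfolding c_def by (auto intro!: derivative_eq_intros)
  have "Ck_on k J UNIV c" for k
  proof (cases k)
    case 0
    then show ?thesis by (auto simp: c_def intro!: continuous_intros)
  next
    case (Suc m)
    then show ?thesis
      unfolding Suc Ck_on.simps
      by (intro exI[of _ "\<lambda>_ s. s *\<^sub>R (h * q)"]) (simp add: der Ck_on_const)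
  qed
  then have "smooth_curve J c"
    using dens by (simp add: smooth_curve_def)
  moreover have "0 \<in> J" "c 0 = q" "open J" "is_interval J"
    using \<epsilon> by (simp_all add: J_def c_def is_interval_oo)
  moreover have "velocity c 0 = h"
    using velocity_eq_of_derivative[of c "h * q" 0] der[of 0 UNIV] assms(1) densities_pos[OF assms(1)]
    by (simp add: has_vector_derivative_def c_def vec_eq_iff less_imp_neq[THEN not_sym])
  ultimately show ?thesis by blast
qed

text \<open>
  The chain rule in the chart at \<open>p\<close>: the coordinate \<open>exp_chart p (c s)\<close> moves with the transported
  velocity. With \<open>p = c t\<close> this yields existence of the natural gradient, with arbitrary \<open>p\<close> it
  yields its expression in every chart.
\<close>

lemma exp_chart_curve_derivative:
  fixes c :: "real \<Rightarrow> real^'n"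
  assumes "smooth_curve J c" "open J" "t \<in> J" "p \<in> densities"
    and "((\<lambda>u. f (exp_chart_inv p u)) has_derivative D) (at (exp_chart p (c t)) within fiber p)"
  shows "((\<lambda>s. f (c s)) has_real_derivative D (exp_transport (c t) p (velocity c t))) (at t)"
proof -
  have "((\<lambda>s. exp_chart p (c s)) has_derivative
      (\<lambda>s. s *\<^sub>R exp_transport (c t) p (velocity c t))) (at t)"
  proof -
    have "((\<lambda>s. log_vec (c s) - log_vec p) has_derivative (\<lambda>s. s *\<^sub>R velocity c t)) (at t)"
      using smooth_curve_velocity(1)[OF assms(1-3)]
      unfolding has_vector_derivative_def by (auto intro!: derivative_eq_intros)
    from bounded_linear.has_derivative[OF bounded_linear_exp_transport this]
    show ?thesis
      by (simp add: exp_chart_def exp_transport_def vec_eq_scaleR_1 expect_scaleR scaleR_diff_right)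
  qed
  moreover have "range (\<lambda>s. exp_chart p (c s)) \<subseteq> fiber p"
    using exp_chart_in_fiber[OF assms(4)] by blast
  then have "((\<lambda>u. f (exp_chart_inv p u)) has_derivative D)
      (at (exp_chart p (c t)) within range (\<lambda>s. exp_chart p (c s)))"
    using assms(5) by (auto intro: has_derivative_subset)
  ultimately have "((\<lambda>s. f (exp_chart_inv p (exp_chart p (c s)))) has_derivative
      (\<lambda>s. D (s *\<^sub>R exp_transport (c t) p (velocity c t)))) (at t)"
    by (rule has_derivative_in_compose)
  then have "((\<lambda>s. f (c s)) has_derivative
      (\<lambda>s. D (s *\<^sub>R exp_transport (c t) p (velocity c t)))) (at t)"
  proof (rule has_derivative_transform_within_open[OF _ assms(2,3)])
    show "f (exp_chart_inv p (exp_chart p (c s))) = f (c s)" if "s \<in> J" for s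
      using assms(1) that by (simp add: smooth_curve_def exp_chart_inv_exp_chart assms(4))
  qed
  moreover have "D (s *\<^sub>R h) = D h * s" for s h
    using linear_cmul[OF has_derivative_linear[OF assms(5)]] by simp
  ultimately show ?thesis
    by (simp add: has_field_derivative_def)
qed

lemma smooth_field_chart_derivative:
  assumes "smooth_field f" "p \<in> densities" "u \<in> fiber p"
  obtains D where "((\<lambda>u. f (exp_chart_inv p u)) has_derivative D) (at u within fiber p)"
proof -
  have "Ck_on (Suc 0) (fiber p) (fiber p) (\<lambda>u. f (exp_chart_inv p u))"
    using assms by (simp add: smooth_field_def del: Ck_on.simps)
  then show thesis using that assms(3) by auto
qed

text \<open>
  Existence comes from representing the differential of \<open>f\<close> in the chart centered at \<open>q\<close>, and
  uniqueness from the curves of \<open>mixture_curve\<close>, which realize all fiber vectors as velocities.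
\<close>

lemma nat_grad_works:
  fixes f :: "real^'n \<Rightarrow> real"
  assumes "smooth_field f" "q \<in> densities"
  shows "nat_grad f q \<in> fiber q"
    and "\<And>J c t. \<lbrakk>open J; is_interval J; smooth_curve J c; t \<in> J; c t = q\<rbrakk> \<Longrightarrow>
      ((\<lambda>s. f (c s)) has_real_derivative pairing q (nat_grad f q) (velocity c t)) (at t)"
proof -
  let ?P = "\<lambda>\<eta>. \<eta> \<in> fiber q \<and> (\<forall>J c t. open J \<and> is_interval J \<and> smooth_curve J c \<and> t \<in> J \<and> c t = q \<longrightarrow>
      ((\<lambda>s. f (c s)) has_real_derivative pairing q \<eta> (velocity c t)) (at t))"
  obtain D where D: "((\<lambda>u. f (exp_chart_inv q u)) has_derivative D) (at (exp_chart q q) within fiber q)"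
    using smooth_field_chart_derivative[OF assms exp_chart_in_fiber[OF assms(2)]] by blast
  obtain \<eta> where \<eta>: "\<eta> \<in> fiber q" "\<And>v. v \<in> fiber q \<Longrightarrow> pairing q \<eta> v = D v"
    using pairing_represents[OF assms(2) has_derivative_linear[OF D]] by blast
  have "?P \<eta>"
  proof (intro conjI allI impI; (elim conjE)?)
    fix J :: "real set" and c :: "real \<Rightarrow> real^'n" and t :: real
    assume c: "open J" "smooth_curve J c" "t \<in> J" "c t = q"
    have fib: "velocity c t \<in> fiber q"
      using smooth_curve_velocity(2)[OF c(2,1,3)] c(4) by simp
    then have "exp_transport (c t) q (velocity c t) = velocity c t"
      by (simp add: exp_transport_def fiber_def vec_eq_scaleR_1)
    then show "((\<lambda>s. f (c s)) has_real_derivative pairing q \<eta> (velocity c t)) (at t)"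
      using exp_chart_curve_derivative[OF c(2,1,3) assms(2), of f D] D c(4) \<eta>(2)[OF fib] by simp
  qed (fact \<eta>(1))
  moreover have "\<eta>' = \<eta>" if "?P \<eta>'" for \<eta>'
  proof (rule pairing_nondegenerate[OF assms(2)])
    fix v assume "v \<in> fiber q"
    then obtain J c where c: "open J \<and> is_interval J \<and> smooth_curve J c \<and> 0 \<in> J \<and> c 0 = q"
        "velocity c 0 = v"
      using mixture_curve[OF assms(2)] by blast
    have "((\<lambda>s. f (c s)) has_real_derivative pairing q \<zeta> v) (at 0)" if "?P \<zeta>" for \<zeta>
      using conjunct2[OF that, rule_format, OF c(1)] c(2) by simp
    from this[OF \<open>?P \<eta>'\<close>] this[OF \<open>?P \<eta>\<close>]
    show "pairing q \<eta>' v = pairing q \<eta> v"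
      by (rule DERIV_unique)
  qed (use that \<eta> in auto)
  ultimately have "?P (nat_grad f q)"
    unfolding nat_grad_def by (rule theI)
  then show "nat_grad f q \<in> fiber q"
    and "\<And>J c t. \<lbrakk>open J; is_interval J; smooth_curve J c; t \<in> J; c t = q\<rbrakk> \<Longrightarrow>
      ((\<lambda>s. f (c s)) has_real_derivative pairing q (nat_grad f q) (velocity c t)) (at t)"
    by blast+
qed

text \<open>
  Both sides are the derivative of \<open>f\<close> along the same affine curve through \<open>e_p(u)\<close> with velocity \<open>h\<close>.
\<close>

lemma nat_grad_in_chart:
  assumes "smooth_field f" "p \<in> densities" "u \<in> fiber p" "h \<in> fiber (exp_chart_inv p u)"
    and "((\<lambda>u. f (exp_chart_inv p u)) has_derivative D) (at u within fiber p)"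
  shows "D (exp_transport (exp_chart_inv p u) p h)
    = pairing (exp_chart_inv p u) (nat_grad f (exp_chart_inv p u)) h"
proof -
  let ?q = "exp_chart_inv p u"
  have q: "?q \<in> densities" using assms(2) by (rule exp_chart_inv_in_densities)
  obtain J c where c: "open J" "is_interval J" "0 \<in> J" "smooth_curve J c" "c 0 = ?q" "velocity c 0 = h"
    using mixture_curve[OF q assms(4)] by blast
  have "((\<lambda>s. f (c s)) has_real_derivative D (exp_transport ?q p h)) (at 0)"
    using exp_chart_curve_derivative[OF c(4,1,3) assms(2), of f D] assms c(5,6)
    by (simp add: exp_chart_exp_chart_inv)
  moreover have "((\<lambda>s. f (c s)) has_real_derivative pairing ?q (nat_grad f ?q) h) (at 0)"
    using nat_grad_works(2)[OF assms(1) q c(1,2,4,3,5)] c(6) by simp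
  ultimately show ?thesis by (rule DERIV_unique)
qed

section \<open>The two gradients of the damped Kullback-Leibler Lagrangian\<close>

lemma KL_div_chart_inv:
  assumes "q \<in> densities"
  shows "KL_div q (exp_chart_inv q w) = cumulant q w - expect q w"
proof -
  have "ln (q $ x / exp_chart_inv q w $ x) = (vec (cumulant q w) - w) $ x" for x
    using densities_pos[OF assms, of x] by (simp add: exp_chart_inv_def ln_div ln_mult)
  then have "KL_div q (exp_chart_inv q w) = expect q (vec (cumulant q w) - w)"
    by (simp add: KL_div_def expect_def)
  then show ?thesis
    using assms by (simp add: expect_simps)
qed

lemma damped_KL_lagrangian_eq:
  assumes "q \<in> densities" "w \<in> fiber q"
  shows "damped_KL_lagrangian \<alpha> \<beta> \<gamma> f q w t
    = exp (\<alpha> t + \<gamma> t) * (cumulant q (exp (- \<alpha> t) *\<^sub>R w) - exp (\<beta> t) * f q)"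
  using assms
  by (simp add: damped_KL_lagrangian_def KL_div_chart_inv expect_simps fiber_def exp_add algebra_simps)

lemma cumulant_curve_derivative:
  assumes "p \<in> densities" "(u has_vector_derivative u') (at t)"
  shows "((\<lambda>s. cumulant p (u s)) has_real_derivative expect (exp_chart_inv p (u t)) u') (at t)"
proof -
  have "((\<lambda>s. cumulant p (u s)) has_derivative (\<lambda>s. expect (exp_chart_inv p (u t)) (s *\<^sub>R u'))) (at t)"
    using assms(2) cumulant_has_derivative[OF assms(1)]
    unfolding has_vector_derivative_def by (rule has_derivative_compose)
  then show ?thesis
    by (rule has_derivative_imp_has_field_derivative) (simp add: expect_scaleR)
qed

lemma fiber_grad_damped_KL:
  fixes q w :: "real^'n"
  assumes "q \<in> densities" "w \<in> fiber q"
  shows "fiber_grad (damped_KL_lagrangian \<alpha> \<beta> \<gamma> f) q w t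
    = exp (\<gamma> t) *\<^sub>R (tilt q (exp (- \<alpha> t) *\<^sub>R w) - 1)"
    (is "fiber_grad ?L q w t = ?\<eta>")
proof -
  let ?a = "exp (- \<alpha> t)"
  have der: "((\<lambda>s. ?L q (w + s *\<^sub>R \<beta>') t) has_real_derivative pairing q ?\<eta> \<beta>') (at 0)"
    if "\<beta>' \<in> fiber q" for \<beta>'
  proof -
    have "((\<lambda>s. ?a *\<^sub>R (w + s *\<^sub>R \<beta>')) has_vector_derivative ?a *\<^sub>R \<beta>') (at 0)"
      by (auto intro!: derivative_eq_intros)
    from cumulant_curve_derivative[OF assms(1) this]
    have "((\<lambda>s. exp (\<alpha> t + \<gamma> t) * (cumulant q (?a *\<^sub>R (w + s *\<^sub>R \<beta>')) - exp (\<beta> t) * f q))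
        has_real_derivative exp (\<alpha> t + \<gamma> t) * expect (exp_chart_inv q (?a *\<^sub>R w)) (?a *\<^sub>R \<beta>')) (at 0)"
      by (auto intro!: derivative_eq_intros)
    moreover have "w + s *\<^sub>R \<beta>' \<in> fiber q" for s
      using assms(2) that by (intro subspace_add subspace_scale subspace_fiber)
    moreover have "exp (\<alpha> t + \<gamma> t) * expect (exp_chart_inv q (?a *\<^sub>R w)) (?a *\<^sub>R \<beta>') = pairing q ?\<eta> \<beta>'"
      using that
      by (simp add: exp_chart_inv_eq_tilt expect_mult_density pairing_def expect_simps left_diff_distrib
          fiber_def exp_add exp_minus)
    ultimately show ?thesis
      by (simp add: damped_KL_lagrangian_eq[OF assms(1)])
  qed
  have fib: "?\<eta> \<in> fiber q"
    using assms(1) by (simp add: fiber_def expect_simps expect_tilt)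
  show ?thesis
    unfolding fiber_grad_def
  proof (rule the_equality)
    fix \<eta>' assume *: "\<eta>' \<in> fiber q \<and> (\<forall>\<beta>'\<in>fiber q.
      ((\<lambda>s. ?L q (w + s *\<^sub>R \<beta>') t) has_real_derivative pairing q \<eta>' \<beta>') (at 0))"
    show "\<eta>' = ?\<eta>"
    proof (rule pairing_nondegenerate[OF assms(1)])
      show "pairing q \<eta>' v = pairing q ?\<eta> v" if "v \<in> fiber q" for v
        using * that der[OF that] by (blast intro: DERIV_unique)
    qed (use * fib in auto)
  qed (use fib der in blast)
qed

text \<open>
  The centering of \<open>v\<close> at \<open>q = e_p(u)\<close> leaves the term \<open>E_q[v]\<close>, and the cocycle identity turns the
  remaining cumulant at \<open>q\<close> into a difference of cumulants at the fixed point \<open>p\<close>; each summand is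
  then differentiable in \<open>u\<close> by a formula already established.
\<close>

lemma local_damped_KL_eq:
  assumes "p \<in> densities"
  shows "local_lagrangian (damped_KL_lagrangian \<alpha> \<beta> \<gamma> f) p u v t
    = exp (\<alpha> t + \<gamma> t) * (cumulant p (u + exp (- \<alpha> t) *\<^sub>R v) - cumulant p u
        - exp (- \<alpha> t) * expect (exp_chart_inv p u) v - exp (\<beta> t) * f (exp_chart_inv p u))"
proof -
  let ?q = "exp_chart_inv p u" and ?a = "exp (- \<alpha> t)"
  have q: "?q \<in> densities" using assms by (rule exp_chart_inv_in_densities)
  have "exp_transport p ?q v \<in> fiber ?q"
    using q by (simp add: exp_transport_def fiber_def expect_simps)
  moreover have "?a *\<^sub>R exp_transport p ?q v = ?a *\<^sub>R v + vec (- (?a * expect ?q v))"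
    by (simp add: exp_transport_def vec_eq_iff algebra_simps)
  then have "cumulant ?q (?a *\<^sub>R exp_transport p ?q v) = cumulant ?q (?a *\<^sub>R v) + - (?a * expect ?q v)"
    by (simp only: cumulant_add_vec[OF q])
  then have "cumulant ?q (?a *\<^sub>R exp_transport p ?q v)
      = cumulant p (u + ?a *\<^sub>R v) - cumulant p u - ?a * expect ?q v"
    by (simp add: cumulant_chart_inv[OF assms])
  ultimately show ?thesis
    by (simp add: local_lagrangian_def damped_KL_lagrangian_eq[OF q])
qed

lemma local_damped_KL_has_derivative:
  assumes "p \<in> densities" "((\<lambda>u. f (exp_chart_inv p u)) has_derivative Df) (at u within S)"
  shows "((\<lambda>u'. local_lagrangian (damped_KL_lagrangian \<alpha> \<beta> \<gamma> f) p u' v t) has_derivative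
    (\<lambda>k. exp (\<alpha> t + \<gamma> t) * (expect (exp_chart_inv p (u + exp (- \<alpha> t) *\<^sub>R v)) k
        - expect (exp_chart_inv p u) k
        - exp (- \<alpha> t) * expect (exp_chart_inv p u) (v * (k - vec (expect (exp_chart_inv p u) k)))
        - exp (\<beta> t) * Df k))) (at u within S)"
proof -
  have "((\<lambda>u. u + exp (- \<alpha> t) *\<^sub>R v) has_derivative (\<lambda>k. k)) (at u within S)"
    by (auto intro!: derivative_eq_intros)
  from has_derivative_compose[OF this cumulant_has_derivative[OF assms(1)]]
  have "((\<lambda>u. cumulant p (u + exp (- \<alpha> t) *\<^sub>R v)) has_derivative
      (\<lambda>k. expect (exp_chart_inv p (u + exp (- \<alpha> t) *\<^sub>R v)) k)) (at u within S)" .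
  then show ?thesis
    unfolding local_damped_KL_eq[OF assms(1)]
    by (intro has_derivative_mult_right has_derivative_diff assms cumulant_has_derivative
        expect_chart_inv_has_derivative)
qed

text \<open>
  For a tangent vector \<open>h\<close> at \<open>q\<close> and \<open>k = h - E_p[h]\<close> the derivative of the local Lagrangian is
  \<open>E_X[h] - E_q[h] - a E_q[w h] - e\<^sup>\<beta> \<langle>Grad f, h\<rangle>\<close> up to the common factor, where \<open>X = e_q(a w)\<close> and
  \<open>a = e\<^sup>-\<^sup>\<alpha>\<close>: constants drop out of the difference of expectations and out of the covariance. The
  result does not mention \<open>p\<close>, so one vector serves all charts; the chart at \<open>q\<close> itself, where
  \<open>u = 0\<close> and \<open>v = w\<close>, forces uniqueness.
\<close>

lemma base_grad_damped_KL:
  fixes f :: "real^'n \<Rightarrow> real"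
  assumes "smooth_field f" "q \<in> densities" "w \<in> fiber q"
  shows "base_grad (damped_KL_lagrangian \<alpha> \<beta> \<gamma> f) q w t
    = exp (\<alpha> t + \<gamma> t) *\<^sub>R (tilt q (exp (- \<alpha> t) *\<^sub>R w) - 1 - exp (- \<alpha> t) *\<^sub>R w - exp (\<beta> t) *\<^sub>R nat_grad f q)"
    (is "base_grad ?L q w t = ?\<eta>")
proof -
  let ?a = "exp (- \<alpha> t)"
  let ?Q = "\<lambda>\<eta> p u v. \<exists>D. ((\<lambda>u'. local_lagrangian ?L p u' v t) has_derivative D) (at u within fiber p) \<and>
    (\<forall>h\<in>fiber q. pairing q \<eta> h = D (exp_transport q p h))"
  have fib: "?\<eta> \<in> fiber q"
    using assms nat_grad_works(1)[OF assms(1,2)] by (simp add: fiber_def expect_simps expect_tilt)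
  have sol: "?Q ?\<eta> p u v"
    if p: "p \<in> densities" and u: "u \<in> fiber p" and q: "q = exp_chart_inv p u" and w: "w = exp_transport p q v"
    for p u v
  proof -
    obtain Df where Df: "((\<lambda>u. f (exp_chart_inv p u)) has_derivative Df) (at u within fiber p)"
      using smooth_field_chart_derivative[OF assms(1) p u] by blast
    let ?X = "exp_chart_inv p (u + ?a *\<^sub>R v)"
    let ?D = "\<lambda>k. exp (\<alpha> t + \<gamma> t) * (expect ?X k - expect q k
      - ?a * expect q (v * (k - vec (expect q k))) - exp (\<beta> t) * Df k)"
    have D: "((\<lambda>u'. local_lagrangian ?L p u' v t) has_derivative ?D) (at u within fiber p)"
      using local_damped_KL_has_derivative[OF p Df] by (simp add: q)
    have X: "?X = tilt q (?a *\<^sub>R w) * q"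
    proof -
      have "?a *\<^sub>R w = ?a *\<^sub>R v + vec (- (?a * expect q v))"
        by (simp add: w exp_transport_def vec_eq_iff algebra_simps)
      then show ?thesis
        using exp_chart_inv_chart_inv[OF p, of u "?a *\<^sub>R v", folded q]
        by (simp only: exp_chart_inv_eq_tilt[symmetric] exp_chart_inv_add_vec[OF assms(2)])
    qed
    have "pairing q ?\<eta> h = ?D (exp_transport q p h)" if h: "h \<in> fiber q" for h
    proof -
      have h0: "expect q h = 0" using h by (simp add: fiber_def)
      have "expect ?X (exp_transport q p h) - expect q (exp_transport q p h) = expect ?X h"
        using exp_chart_inv_in_densities[OF p, of "u + ?a *\<^sub>R v"] assms(2)
        by (simp add: exp_transport_def expect_simps h0)
      then have "expect ?X (exp_transport q p h) - expect q (exp_transport q p h)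
          = expect q (tilt q (?a *\<^sub>R w) * h)"
        by (simp only: X expect_mult_density)
      moreover have "exp_transport q p h - vec (expect q (exp_transport q p h)) = h"
        using assms(2) by (simp add: exp_transport_def expect_simps h0 vec_neg)
      moreover have "expect q (v * h) = expect q (w * h)"
        by (simp add: w exp_transport_def vec_eq_scaleR_1 left_diff_distrib expect_simps h0)
      moreover have "Df (exp_transport q p h) = pairing q (nat_grad f q) h"
        using nat_grad_in_chart[OF assms(1) p u _ Df] h by (simp add: q)
      ultimately show ?thesis
        by (simp add: pairing_def left_diff_distrib expect_simps h0)
    qed
    with D show ?thesis by blast
  qed
  show ?thesis
    unfolding base_grad_def
  proof (rule the_equality)
    fix \<eta>' assume *: "\<eta>' \<in> fiber q \<and> (\<forall>p\<in>densities. \<forall>u\<in>fiber p. \<forall>v\<in>fiber p.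
      q = exp_chart_inv p u \<and> w = exp_transport p q v \<longrightarrow> ?Q \<eta>' p u v)"
    have 0: "0 \<in> fiber q" "q = exp_chart_inv q 0" "w = exp_transport q q w"
      using assms(2,3)
      by (simp_all add: fiber_def expect_simps exp_chart_inv_def cumulant_0 exp_transport_def
          vec_eq_scaleR_1)
    then have "?Q \<eta>' q 0 w"
      using * assms(2,3) by blast
    then obtain D' where D': "((\<lambda>u'. local_lagrangian ?L q u' w t) has_derivative D') (at 0 within fiber q)"
      "\<And>h. h \<in> fiber q \<Longrightarrow> pairing q \<eta>' h = D' (exp_transport q q h)"
      by blast
    obtain D where D: "((\<lambda>u'. local_lagrangian ?L q u' w t) has_derivative D) (at 0 within fiber q)"
      "\<And>h. h \<in> fiber q \<Longrightarrow> pairing q ?\<eta> h = D (exp_transport q q h)"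
      using sol[OF assms(2) 0] by blast
    show "\<eta>' = ?\<eta>"
    proof (rule pairing_nondegenerate[OF assms(2)])
      fix h assume h: "h \<in> fiber q"
      have "exp_transport q q h \<in> fiber q"
        using assms(2) by (simp add: exp_transport_def fiber_def expect_simps)
      from has_derivative_within_subspace_unique[OF D'(1) D(1) subspace_fiber 0(1) this]
      show "pairing q \<eta>' h = pairing q ?\<eta> h"
        by (simp add: D D' h)
    qed (use * fib in auto)
  qed (use fib sol in blast)
qed

section \<open>The Euler-Lagrange equation along a curve\<close>

lemma tilt_curve_derivative:
  fixes q W :: "real \<Rightarrow> real^'n"
  assumes "smooth_curve J q" "open J" "t \<in> J" "(W has_vector_derivative W') (at t)"
  shows "((\<lambda>s. tilt (q s) (W s)) has_vector_derivative
    tilt (q t) (W t) * (W' - vec (expect (exp_chart_inv (q t) (W t)) (velocity q t + W')))) (at t)"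
proof -
  let ?K = "\<lambda>s. cumulant 1 (log_vec (q s) + W s)"
  let ?E = "expect (exp_chart_inv (q t) (W t)) (velocity q t + W')"
  have dens: "q s \<in> densities" if "s \<in> J" for s
    using assms(1) that by (simp add: smooth_curve_def)
  have "((\<lambda>s. log_vec (q s) + W s) has_vector_derivative velocity q t + W') (at t)"
    using smooth_curve_velocity(1)[OF assms(1-3)] assms(4) by (rule has_vector_derivative_add)
  from cumulant_curve_derivative[OF one_density this]
  have "(?K has_real_derivative ?E) (at t)"
    by (simp only: cumulant_eq_uniform(2)[OF dens[OF assms(3)]])
  then have "((\<lambda>s. \<chi> x. exp (W s $ x - ?K s)) has_vector_derivative
      (\<chi> x. exp (W t $ x - ?K t) * (W' $ x - ?E))) (at t)"
    using assms(4) unfolding has_vector_derivative_vec_iff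
    by (auto intro!: derivative_eq_intros)
  then have "((\<lambda>s. tilt (q s) (W s)) has_vector_derivative
      (\<chi> x. exp (W t $ x - ?K t) * (W' $ x - ?E))) (at t)"
    by (rule has_vector_derivative_transform_within_open[OF _ assms(2,3)])
      (simp add: tilt_def cumulant_eq_uniform(1)[OF dens])
  moreover have "(\<chi> x. exp (W t $ x - ?K t) * (W' $ x - ?E)) = tilt (q t) (W t) * (W' - vec ?E)"
    by (simp add: tilt_def cumulant_eq_uniform(1)[OF dens[OF assms(3)]] vec_eq_iff)
  ultimately show ?thesis by simp
qed

lemma mixture_deriv_fiber_grad:
  fixes q :: "real \<Rightarrow> real^'n"
  assumes "smooth_curve J q" "open J" "t \<in> J"
    and "(\<alpha> has_real_derivative \<alpha>') (at t)" "(\<gamma> has_real_derivative \<gamma>') (at t)"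
  defines "w \<equiv> velocity q t"
    and "W' \<equiv> exp (- \<alpha> t) *\<^sub>R vector_derivative (velocity q) (at t) - (\<alpha>' * exp (- \<alpha> t)) *\<^sub>R velocity q t"
    and "\<rho> \<equiv> tilt (q t) (exp (- \<alpha> t) *\<^sub>R velocity q t)"
  shows "mixture_deriv q (\<lambda>s. fiber_grad (damped_KL_lagrangian \<alpha> \<beta> \<gamma> f) (q s) (velocity q s) s) t
    = exp (\<gamma> t) *\<^sub>R (w * (\<rho> - 1) + \<gamma>' *\<^sub>R (\<rho> - 1) + \<rho> * (W' - vec (expect (\<rho> * q t) (w + W'))))"
proof -
  let ?W = "\<lambda>s. exp (- \<alpha> s) *\<^sub>R velocity q s"
  let ?\<eta> = "\<lambda>s. exp (\<gamma> s) *\<^sub>R (tilt (q s) (?W s) - 1)"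
  let ?\<rho>' = "\<rho> * (W' - vec (expect (\<rho> * q t) (w + W')))"
  have grad: "fiber_grad (damped_KL_lagrangian \<alpha> \<beta> \<gamma> f) (q s) (velocity q s) s = ?\<eta> s" if "s \<in> J" for s
    using assms(1) that smooth_curve_velocity(2)[OF assms(1,2) that]
    by (intro fiber_grad_damped_KL) (auto simp: smooth_curve_def)
  have "(?W has_vector_derivative W') (at t)"
    using smooth_curve_velocity(3)[OF assms(1-3)] assms(4)
    unfolding W'_def by (auto intro!: derivative_eq_intros simp: has_vector_derivative_vec_iff)
  from tilt_curve_derivative[OF assms(1-3) this]
  have "((\<lambda>s. tilt (q s) (?W s)) has_vector_derivative ?\<rho>') (at t)"
    by (simp add: w_def \<rho>_def exp_chart_inv_eq_tilt)
  then have "(?\<eta> has_vector_derivative exp (\<gamma> t) *\<^sub>R ?\<rho>' + (exp (\<gamma> t) * \<gamma>') *\<^sub>R (\<rho> - 1)) (at t)"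
    using assms(5) unfolding has_vector_derivative_vec_iff \<rho>_def
    by (auto intro!: derivative_eq_intros)
  then have "((\<lambda>s. fiber_grad (damped_KL_lagrangian \<alpha> \<beta> \<gamma> f) (q s) (velocity q s) s) has_vector_derivative
      exp (\<gamma> t) *\<^sub>R ?\<rho>' + (exp (\<gamma> t) * \<gamma>') *\<^sub>R (\<rho> - 1)) (at t)"
    by (rule has_vector_derivative_transform_within_open[OF _ assms(2,3)]) (simp add: grad)
  then show ?thesis
    unfolding mixture_deriv_def grad[OF assms(3)]
    unfolding \<rho>_def[symmetric] unfolding w_def[symmetric]
    by (simp add: vector_derivative_at vec_eq_iff algebra_simps)
qed

text \<open>
  An equation between functions centered at \<open>X\<close> is equivalent to the same equation centered at \<open>q\<close>:
  both say that \<open>Y\<close> and \<open>Z\<close> differ by a constant, and \<open>E_X[Z] = 0\<close> determines that constant.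
\<close>

lemma centering_change_density:
  assumes "q \<in> densities" "X \<in> densities" "expect X Z = 0"
  shows "Y - vec (expect X Y) = Z \<longleftrightarrow> Y - vec (expect q Y) = Z - vec (expect q Z)"
proof
  assume "Y - vec (expect X Y) = Z"
  then show "Y - vec (expect q Y) = Z - vec (expect q Z)"
    using assms(1) by (auto simp: expect_simps vec_sub)
next
  assume "Y - vec (expect q Y) = Z - vec (expect q Z)"
  then have Y: "Y = Z + vec (expect q Y - expect q Z)"
    by (simp add: vec_sub algebra_simps)
  then have "expect X Y = expect q Y - expect q Z"
    using assms(2,3) by (metis add_0 expect_add expect_vec)
  with Y show "Y - vec (expect X Y) = Z"
    by (metis add_diff_cancel_right')
qed

text \<open>
  After cancelling the common factor \<open>e\<^sup>\<gamma>\<close> the terms \<open>- w\<close> on the two sides cancel, because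
  \<open>e\<^sup>\<alpha> a = 1\<close>; division by \<open>\<rho> = X / q\<close> then isolates \<open>Y = w + d/dt (a w)\<close>, which appears
  centered at \<open>X\<close>. Recentering at \<open>q\<close> produces the accelerated form.
\<close>

lemma euler_lagrange_damped_KL:
  fixes q :: "real \<Rightarrow> real^'n"
  assumes "smooth_field f" "smooth_curve J q" "open J" "t \<in> J"
    and "(\<alpha> has_real_derivative \<alpha>') (at t)" "(\<gamma> has_real_derivative \<gamma>') (at t)"
  defines "X \<equiv> exp_chart_inv (q t) (exp (- \<alpha> t) *\<^sub>R velocity q t)"
    and "G \<equiv> nat_grad f (q t)"
  defines "r \<equiv> \<chi> x. q t $ x / X $ x"
  shows "euler_lagrange (damped_KL_lagrangian \<alpha> \<beta> \<gamma> f) q t \<longleftrightarrow>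
    exp (- \<alpha> t) *\<^sub>R acceleration q t + (1 - \<alpha>' * exp (- \<alpha> t)) *\<^sub>R velocity q t
      = (exp (\<alpha> t) - \<gamma>') *\<^sub>R (- r + vec (expect (q t) r))
        - exp (\<alpha> t + \<beta> t) *\<^sub>R (r * G - vec (expect (q t) (r * G)))"
proof -
  define a where "a = exp (- \<alpha> t)"
  define w where "w = velocity q t"
  define w' where "w' = vector_derivative (velocity q) (at t)"
  define W' where "W' = a *\<^sub>R w' - (\<alpha>' * a) *\<^sub>R w"
  define \<rho> where "\<rho> = tilt (q t) (a *\<^sub>R w)"
  define Y where "Y = w + W'"
  define Z where "Z = (exp (\<alpha> t) - \<gamma>') *\<^sub>R (1 - r) - exp (\<alpha> t + \<beta> t) *\<^sub>R (r * G)"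
  have qt: "q t \<in> densities"
    using assms(2,4) by (simp add: smooth_curve_def)
  have w0: "w \<in> fiber (q t)"
    unfolding w_def using assms(2-4) by (rule smooth_curve_velocity(2))
  have X: "X = \<rho> * q t" "X \<in> densities"
    using qt by (simp_all add: X_def \<rho>_def a_def w_def exp_chart_inv_eq_tilt[symmetric]
        exp_chart_inv_in_densities)
  have \<rho>pos: "0 < \<rho> $ x" for x by (simp add: \<rho>_def tilt_def)
  have r: "r $ x = 1 / \<rho> $ x" for x
    using densities_pos[OF qt, of x] by (simp add: r_def X(1))
  have \<rho>r: "\<rho> * r = 1" "\<rho> * (r * g) = g" for g
    using \<rho>pos by (simp_all add: vec_eq_iff r less_imp_neq[THEN not_sym])
  \<comment> \<open>Under \<open>X\<close>, \<open>r = q / X\<close> has expectation 1 and \<open>r G\<close> has expectation \<open>E_q[G] = 0\<close>.\<close>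
  have "expect X Z = 0"
    using qt nat_grad_works(1)[OF assms(1) qt] X(2)
    by (simp add: Z_def expect_simps) (simp add: X(1) expect_mult_density \<rho>r expect_simps fiber_def G_def)
  have "euler_lagrange (damped_KL_lagrangian \<alpha> \<beta> \<gamma> f) q t \<longleftrightarrow>
      exp (\<gamma> t) *\<^sub>R (w * (\<rho> - 1) + \<gamma>' *\<^sub>R (\<rho> - 1) + \<rho> * (W' - vec (expect X Y)))
        = exp (\<alpha> t + \<gamma> t) *\<^sub>R (\<rho> - 1 - a *\<^sub>R w - exp (\<beta> t) *\<^sub>R G)"
    unfolding euler_lagrange_def
    by (simp add: mixture_deriv_fiber_grad[OF assms(2-6)] base_grad_damped_KL[OF assms(1) qt w0[unfolded w_def]]
        X(1) Y_def W'_def \<rho>_def a_def w_def w'_def G_def)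
  also have "\<dots> \<longleftrightarrow> (\<forall>x. \<rho> $ x * (Y $ x - expect X Y) =
      (exp (\<alpha> t) - \<gamma>') * (\<rho> $ x - 1) - exp (\<alpha> t + \<beta> t) * G $ x)"
  proof -
    have "exp (\<gamma> t) * (w $ x * (\<rho> $ x - 1) + \<gamma>' * (\<rho> $ x - 1) + \<rho> $ x * (W' $ x - e))
        = exp (\<alpha> t + \<gamma> t) * (\<rho> $ x - 1 - a * w $ x - exp (\<beta> t) * G $ x)
      \<longleftrightarrow> \<rho> $ x * (Y $ x - e) = (exp (\<alpha> t) - \<gamma>') * (\<rho> $ x - 1) - exp (\<alpha> t + \<beta> t) * G $ x" for x e
    proof -
      have "exp (\<alpha> t) * a = 1" by (simp add: a_def exp_minus)
      then have "exp (\<alpha> t + \<gamma> t) * (\<rho> $ x - 1 - a * w $ x - exp (\<beta> t) * G $ x)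
          = exp (\<gamma> t) * (exp (\<alpha> t) * (\<rho> $ x - 1) - w $ x - exp (\<alpha> t + \<beta> t) * G $ x)"
        by (simp add: exp_add algebra_simps)
      moreover have "w $ x * (\<rho> $ x - 1) + \<gamma>' * (\<rho> $ x - 1) + \<rho> $ x * (W' $ x - e)
          = \<rho> $ x * (Y $ x - e) - w $ x + \<gamma>' * (\<rho> $ x - 1)"
        by (simp add: Y_def algebra_simps)
      ultimately show ?thesis
        by (simp only: mult_cancel_left exp_not_eq_zero simp_thms) (auto simp: algebra_simps)
    qed
    then show ?thesis by (simp add: vec_eq_iff)
  qed
  also have "\<dots> \<longleftrightarrow> Y - vec (expect X Y) = Z"
  proof -
    have "\<rho> $ x * y = (exp (\<alpha> t) - \<gamma>') * (\<rho> $ x - 1) - exp (\<alpha> t + \<beta> t) * G $ x \<longleftrightarrow> y = Z $ x" for x y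
    proof -
      have "\<rho> $ x * Z $ x = (exp (\<alpha> t) - \<gamma>') * (\<rho> $ x - 1) - exp (\<alpha> t + \<beta> t) * G $ x"
        using \<rho>pos[of x] by (simp add: Z_def r field_simps)
      then show ?thesis
        using \<rho>pos[of x] by (metis mult_cancel_left less_irrefl)
    qed
    then show ?thesis by (simp add: vec_eq_iff)
  qed
  also have "\<dots> \<longleftrightarrow> Y - vec (expect (q t) Y) = Z - vec (expect (q t) Z)"
    using qt X(2) \<open>expect X Z = 0\<close> by (rule centering_change_density)
  also have "Y - vec (expect (q t) Y)
      = exp (- \<alpha> t) *\<^sub>R acceleration q t + (1 - \<alpha>' * exp (- \<alpha> t)) *\<^sub>R velocity q t"
    using w0 unfolding acceleration_def fiber_def Y_def W'_def w'_def[symmetric] w_def[symmetric] a_def[symmetric]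
    by (simp add: expect_simps vec_eq_iff algebra_simps)
  also have "Z - vec (expect (q t) Z) = (exp (\<alpha> t) - \<gamma>') *\<^sub>R (- r + vec (expect (q t) r))
        - exp (\<alpha> t + \<beta> t) *\<^sub>R (r * G - vec (expect (q t) (r * G)))"
    using qt by (simp add: Z_def expect_simps vec_eq_iff algebra_simps)
  finally show ?thesis .
qed

theorem mainTheorem7:
  fixes I :: "real set" and \<alpha> \<beta> \<gamma> :: "real \<Rightarrow> real"
    and f :: "real^'n \<Rightarrow> real" and q :: "real \<Rightarrow> real^'n"
  assumes "open I" and "is_interval I"
    and "\<alpha> C1_differentiable_on I" and "\<beta> C1_differentiable_on I" and "\<gamma> C1_differentiable_on I"
    and "smooth_field f"
    and "smooth_curve I q"
  defines "L \<equiv> damped_KL_lagrangian \<alpha> \<beta> \<gamma> f"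
    and "X \<equiv> \<lambda>t. exp_chart_inv (q t) (exp (- \<alpha> t) *\<^sub>R velocity q t)"
  defines "r \<equiv> \<lambda>t. \<chi> x. q t $ x / X t $ x"
    and "G \<equiv> \<lambda>t. nat_grad f (q t)"
  shows
    "(\<forall>p\<in>densities. \<forall>w\<in>fiber p. \<forall>t\<in>I.
        L p w t = exp (\<alpha> t + \<gamma> t) * (cumulant p (exp (- \<alpha> t) *\<^sub>R w) - exp (\<beta> t) * f p))
     \<and> (\<forall>t\<in>I. euler_lagrange L q t \<longleftrightarrow>
        exp (- \<alpha> t) *\<^sub>R acceleration q t + (1 - deriv \<alpha> t * exp (- \<alpha> t)) *\<^sub>R velocity q t
          = (exp (\<alpha> t) - deriv \<gamma> t) *\<^sub>R (- r t + vec (expect (q t) (r t)))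
            - exp (\<alpha> t + \<beta> t) *\<^sub>R (r t * G t - vec (expect (q t) (r t * G t))))
     \<and> ((\<forall>t\<in>I. deriv \<beta> t \<le> exp (\<alpha> t) \<and> deriv \<gamma> t = exp (\<alpha> t)) \<longrightarrow>
        (\<forall>t\<in>I. euler_lagrange L q t \<longleftrightarrow>
          acceleration q t + (exp (\<alpha> t) - deriv \<alpha> t) *\<^sub>R velocity q t
            = - (exp (2 * \<alpha> t + \<beta> t) *\<^sub>R (r t * G t - vec (expect (q t) (r t * G t))))))"
proof (intro conjI ballI impI)
  have deriv: "(g has_real_derivative deriv g t) (at t)" if "g C1_differentiable_on I" "t \<in> I"
    for g :: "real \<Rightarrow> real" and t
    using that DERIV_imp_deriv
    unfolding C1_differentiable_on_def has_real_derivative_iff_has_vector_derivative[symmetric]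
    by metis
  have EL: "euler_lagrange L q t \<longleftrightarrow>
        exp (- \<alpha> t) *\<^sub>R acceleration q t + (1 - deriv \<alpha> t * exp (- \<alpha> t)) *\<^sub>R velocity q t
          = (exp (\<alpha> t) - deriv \<gamma> t) *\<^sub>R (- r t + vec (expect (q t) (r t)))
            - exp (\<alpha> t + \<beta> t) *\<^sub>R (r t * G t - vec (expect (q t) (r t * G t)))" if "t \<in> I" for t
    using euler_lagrange_damped_KL[OF assms(6,7,1) that deriv[OF assms(3) that] deriv[OF assms(5) that]]
    by (simp add: L_def r_def X_def G_def)
  show "L p w t = exp (\<alpha> t + \<gamma> t) * (cumulant p (exp (- \<alpha> t) *\<^sub>R w) - exp (\<beta> t) * f p)"
    if "p \<in> densities" "w \<in> fiber p" for p w t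
    using that unfolding L_def by (rule damped_KL_lagrangian_eq)
  show "euler_lagrange L q t \<longleftrightarrow>
        exp (- \<alpha> t) *\<^sub>R acceleration q t + (1 - deriv \<alpha> t * exp (- \<alpha> t)) *\<^sub>R velocity q t
          = (exp (\<alpha> t) - deriv \<gamma> t) *\<^sub>R (- r t + vec (expect (q t) (r t)))
            - exp (\<alpha> t + \<beta> t) *\<^sub>R (r t * G t - vec (expect (q t) (r t * G t)))" if "t \<in> I" for t
    using that by (rule EL)
  fix t
  assume ideal: "\<forall>t\<in>I. deriv \<beta> t \<le> exp (\<alpha> t) \<and> deriv \<gamma> t = exp (\<alpha> t)" and "t \<in> I"
  define V where "V = r t * G t - vec (expect (q t) (r t * G t))"
  let ?A = "acceleration q t" and ?w = "velocity q t"
  have "euler_lagrange L q t \<longleftrightarrow>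
      exp (- \<alpha> t) *\<^sub>R ?A + (1 - deriv \<alpha> t * exp (- \<alpha> t)) *\<^sub>R ?w = - (exp (\<alpha> t + \<beta> t) *\<^sub>R V)"
    using EL[OF \<open>t \<in> I\<close>] ideal \<open>t \<in> I\<close> by (simp add: V_def)
  also have "\<dots> \<longleftrightarrow> exp (\<alpha> t) *\<^sub>R (exp (- \<alpha> t) *\<^sub>R ?A + (1 - deriv \<alpha> t * exp (- \<alpha> t)) *\<^sub>R ?w)
      = exp (\<alpha> t) *\<^sub>R (- (exp (\<alpha> t + \<beta> t) *\<^sub>R V))"
    by (simp only: scaleR_cancel_left exp_not_eq_zero simp_thms)
  also have "exp (\<alpha> t) *\<^sub>R (exp (- \<alpha> t) *\<^sub>R ?A + (1 - deriv \<alpha> t * exp (- \<alpha> t)) *\<^sub>R ?w)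
      = ?A + (exp (\<alpha> t) - deriv \<alpha> t) *\<^sub>R ?w"
    by (simp add: vec_eq_iff exp_minus field_simps)
  also have "exp (\<alpha> t) *\<^sub>R (- (exp (\<alpha> t + \<beta> t) *\<^sub>R V)) = - (exp (2 * \<alpha> t + \<beta> t) *\<^sub>R V)"
    by (simp add: exp_add[symmetric])
  finally show "euler_lagrange L q t \<longleftrightarrow> ?A + (exp (\<alpha> t) - deriv \<alpha> t) *\<^sub>R ?w
      = - (exp (2 * \<alpha> t + \<beta> t) *\<^sub>R (r t * G t - vec (expect (q t) (r t * G t))))"
    by (simp only: V_def)
qed

end
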